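(* Let $d\in\mathbb{N}$, let $\mu$ be a probability measure on $\mathbb{R}^d$ and let $f\in L^2(\mathbb{R}^d,\mu)$ be real-valued. Then for any $\varepsilon>0$ there exist $n\in\mathbb{N}$, $R>0$ and $\boldsymbol\theta\in\boldsymbol\Theta=(\mathbb{R}^d\times\mathbb{R}\times[0,2\pi])^n$ such that the output $f_{\boldsymbol\theta}:=f^R_{n,\boldsymbol\theta}$ of the quantum circuit $\mathtt C_{\mathfrak n}(\boldsymbol\theta,\cdot)$ (defined in the context) satisfies $$\left(\int_{\mathbb{R}^d}|f(\boldsymbol x)-f_{\boldsymbol\theta}(\boldsymbol x)|^2\mu(d\boldsymbol x)\right)^{1/2}\le\varepsilon.$$
   Context: Quantum circuit. Let $n\in\mathbb{N}$, $\boldsymbol\theta=(\boldsymbol a^i,b^i,\gamma^i)_{i=1,\dots,n}\in\boldsymbol\Theta=(\mathbb{R}^d\times\mathbb{R}\times[0,2\pi])^n$, $\boldsymbol x\in\mathbb{R}^d$. Let $\mathtt H=\frac1{\sqrt2}\begin{pmatrix}1&1\\1&-1\end{pmatrix}$, $\mathtt R_y(\gamma)=\begin{pmatrix}\cos(\gamma/2)&-\sin(\gamma/2)\\ \sin(\gamma/2)&\cos(\gamma/2)\end{pmatrix}$, $\mathtt R_z(\alpha)=\begin{pmatrix}e^{-\mathrm i\alpha/2}&0\\0&e^{\mathrm i\alpha/2}\end{pmatrix}$. For $i=1,\dots,n$ put $\mathtt U_1^{(i)}=\mathtt H\,\mathtt R_z(-b^i)\,\mathtt R_z(-a^i_dx_d)\cdots\mathtt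 R_z(-a^i_1x_1)\,\mathtt H$, $\mathtt U_2^{(i)}=\mathtt R_y(\gamma^i)$, and $\bar{\mathtt U}^{(i)}=\mathtt U_1^{(i)}\otimes\mathtt U_2^{(i)}\in\mathbb{C}^{4\times4}$ (Kronecker product). Let $n_0\ge0$ be the smallest integer with $\log_2(4n+n_0)\in\mathbb{N}$, $\mathfrak n=\lceil\log_2(4n)\rceil$, $N=4n+n_0=2^{\mathfrak n}$, and let $\mathtt U(\boldsymbol\theta,\boldsymbol x)\in\mathbb{C}^{N\times N}$ be the block-diagonal unitary matrix with diagonal blocks $\bar{\mathtt U}^{(1)},\dots,\bar{\mathtt U}^{(n)}$ and the $n_0\times n_0$ identity. Denote by $|0\rangle,\dots,|N-1\rangle$ the computational (standard) basis of $\mathbb{C}^N$, with $|0\rangle=|0\rangle^{\otimes\mathfrak n}$, and let $\mathtt V\in\mathbb{C}^{N\times N}$ be any unitary matrix mapping $|0\rangle^{\otimes\mathfrak n}$ to $|\psi\rangle=\frac1{\sqrt n}\sum_{i=0}^{n-1}|4i\rangle$. The circuit is $\mathtt C_{\mathfrak n}(\boldsymbol\theta,\boldsymbol x)=\mathtt U(\boldsymbol\theta,\boldsymbol x)\mathtt V$. For $m\in\{0,1,2,3\}$, $\mathbb{P}^n_m(\boldsymbol\theta,\boldsymbol x)$ is the probability that measuring $\mathtt C_{\mathfrak n}(\boldsymbol\theta,\boldsymbol x)|0\rangle^{\otimes\mathfrak n}$ in the computational basis gives an outcome in $\{m,4+m,\dots,4(n-1)+m\}$, i.e. $\mathbb{P}^n_m=\sum_{i=0}^{n-1}|\langle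 4i+m|\mathtt U\mathtt V|0\rangle^{\otimes\mathfrak n}|^2$. For $R>0$, the output function (quantum neural network) is $$f^R_{n,\boldsymbol\theta}(\boldsymbol x)=R-2R\left[\mathbb{P}^n_1(\boldsymbol\theta,\boldsymbol x)+\mathbb{P}^n_2(\boldsymbol\theta,\boldsymbol x)\right].$$ *)

theory Defs
  imports "HOL-Probability.Probability" "Jordan_Normal_Form.Schur_Decomposition"
begin

text \<open>
  Vectors and matrices of the quantum circuit are the dimension-carrying
  \<open>complex vec\<close> and \<open>complex mat\<close>. The input space is \<open>real ^ 'd\<close>; the linear order on the
  index type \<open>'d\<close> plays the role of the order of the coordinates 1, ..., d. Since \<open>$\<close> is
  overloaded here, coordinates of inputs are written with \<open>vec_nth\<close>.
\<close>

type_synonym 'd point = "real ^ 'd"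

definition unitary_mat :: "nat \<Rightarrow> complex mat \<Rightarrow> bool" where
  "unitary_mat N A \<longleftrightarrow>
     A \<in> carrier_mat N N \<and> mat_adjoint A * A = 1\<^sub>m N \<and> A * mat_adjoint A = 1\<^sub>m N"

definition kronecker :: "'a::semiring_0 mat \<Rightarrow> 'a mat \<Rightarrow> 'a mat" where
  "kronecker A B = mat (dim_row A * dim_row B) (dim_col A * dim_col B)
     (\<lambda>(i, j). A $$ (i div dim_row B, j div dim_col B) * B $$ (i mod dim_row B, j mod dim_col B))"

definition H_gate :: "complex mat" where
  "H_gate = complex_of_real (1 / sqrt 2) \<cdot>\<^sub>m mat_of_rows_list 2 [[1, 1], [1, -1]]"

definition Ry_gate :: "real \<Rightarrow> complex mat" where
  "Ry_gate \<gamma> = mat_of_rows_list 2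
     [[complex_of_real (cos (\<gamma> / 2)), - complex_of_real (sin (\<gamma> / 2))],
      [complex_of_real (sin (\<gamma> / 2)), complex_of_real (cos (\<gamma> / 2))]]"

definition Rz_gate :: "real \<Rightarrow> complex mat" where
  "Rz_gate \<alpha> = mat_of_rows_list 2
     [[exp (- (\<i> * complex_of_real \<alpha> / 2)), 0],
      [0, exp (\<i> * complex_of_real \<alpha> / 2)]]"

text \<open>The product of the gates for the coordinates d, ..., 1, from left to right.\<close>

definition encoding_gates ::
  "'d::{finite, linorder} point \<Rightarrow> 'd point \<Rightarrow> complex mat" where
  "encoding_gates a x =
     foldr (\<lambda>j M. Rz_gate (- (vec_nth a j * vec_nth x j)) * M)
       (rev (sorted_list_of_set (UNIV :: 'd set))) (1\<^sub>m 2)"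

definition U1_gate ::
  "'d::{finite, linorder} point \<Rightarrow> real \<Rightarrow> 'd point \<Rightarrow> complex mat" where
  "U1_gate a b x = H_gate * Rz_gate (- b) * encoding_gates a x * H_gate"

text \<open>Parameters: \<open>\<theta> i = (a\<^sup>i, b\<^sup>i, \<gamma>\<^sup>i)\<close> for \<open>i = 1, ..., n\<close>.\<close>

type_synonym 'd params = "nat \<Rightarrow> 'd point \<times> real \<times> real"

definition param_space :: "nat \<Rightarrow> 'd::finite params set" where
  "param_space n = {1..n} \<rightarrow>\<^sub>E UNIV \<times> UNIV \<times> {0..2 * pi}"

definition U_block ::
  "'d::{finite, linorder} point \<times> real \<times> real \<Rightarrow> 'd point \<Rightarrow> complex mat" where
  "U_block p x = (case p of (a, b, \<gamma>) \<Rightarrow> kronecker (U1_gate a b x) (Ry_gate \<gamma>))"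

definition padding :: "nat \<Rightarrow> nat" where
  "padding n = (LEAST n0. log 2 (real (4 * n + n0)) \<in> \<nat>)"

definition num_qubits :: "nat \<Rightarrow> nat" where
  "num_qubits n = nat \<lceil>log 2 (real (4 * n))\<rceil>"

definition circuit_dim :: "nat \<Rightarrow> nat" where
  "circuit_dim n = 4 * n + padding n"

lemma circuit_dim_eq:
  assumes "n \<ge> 1"
  shows "circuit_dim n = 2 ^ num_qubits n"
proof -
  let ?q = "num_qubits n"
  have pos: "real (4 * n) \<ge> 1" using assms by simp
  have l0: "log 2 (real (4 * n)) \<ge> 0" using pos by simp
  have "log 2 (real (4 * n)) \<le> real ?q"
    unfolding num_qubits_def using l0 by linarith
  then have "real (4 * n) \<le> 2 powr real ?q" using pos by (simp add: log_le_iff)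
  then have "real (4 * n) \<le> real (2 ^ ?q)" by (simp add: powr_realpow)
  then have le: "4 * n \<le> 2 ^ ?q" by (simp only: of_nat_le_iff)
  have "padding n = 2 ^ ?q - 4 * n"
    unfolding padding_def
  proof (rule Least_equality)
    have "4 * n + (2 ^ ?q - 4 * n) = 2 ^ ?q" using le by simp
    then show "log 2 (real (4 * n + (2 ^ ?q - 4 * n))) \<in> \<nat>"
      by (simp only: of_nat_power of_nat_numeral log_nat_power) (simp add: log_def)
  next
    fix m assume "log 2 (real (4 * n + m)) \<in> \<nat>"
    then obtain k where k: "log 2 (real (4 * n + m)) = real k" by (auto elim: Nats_cases)
    have "log 2 (real (4 * n)) \<le> real k"
      unfolding k[symmetric] using pos by simp
    then have "?q \<le> k" unfolding num_qubits_def by linarith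
    then have "(2::nat) ^ ?q \<le> 2 ^ k" by simp
    moreover have "real (4 * n + m) = 2 powr real k"
      unfolding k[symmetric] using pos by simp
    then have "real (4 * n + m) = real (2 ^ k)" by (simp add: powr_realpow)
    then have "4 * n + m = 2 ^ k" by (simp only: of_nat_eq_iff)
    ultimately show "2 ^ ?q - 4 * n \<le> m" by linarith
  qed
  then show ?thesis using le unfolding circuit_dim_def by simp
qed

definition U_mat ::
  "nat \<Rightarrow> 'd::{finite, linorder} params \<Rightarrow> 'd point \<Rightarrow> complex mat" where
  "U_mat n \<theta> x = diag_block_mat (map (\<lambda>i. U_block (\<theta> i) x) [1..<n + 1] @ [1\<^sub>m (padding n)])"

definition ket :: "nat \<Rightarrow> nat \<Rightarrow> complex vec" where
  "ket n j = unit_vec (circuit_dim n) j"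

definition psi_state :: "nat \<Rightarrow> complex vec" where
  "psi_state n = complex_of_real (1 / sqrt (real n)) \<cdot>\<^sub>v
     finsum_vec TYPE(complex) (circuit_dim n) (\<lambda>i. ket n (4 * i)) {..<n}"

definition prepares_psi :: "nat \<Rightarrow> complex mat \<Rightarrow> bool" where
  "prepares_psi n V \<longleftrightarrow> unitary_mat (circuit_dim n) V \<and> V *\<^sub>v ket n 0 = psi_state n"

definition circuit ::
  "complex mat \<Rightarrow> nat \<Rightarrow> 'd::{finite, linorder} params \<Rightarrow> 'd point \<Rightarrow> complex mat" where
  "circuit V n \<theta> x = U_mat n \<theta> x * V"

text \<open>\<open>\<phi> \<bullet>c \<psi>\<close> is conjugate-linear in \<open>\<psi>\<close>, i.e. it is the inner product of \<open>\<psi>\<close> (bra) and \<open>\<phi>\<close> (ket).\<close>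

definition outcome_prob ::
  "complex mat \<Rightarrow> nat \<Rightarrow> nat \<Rightarrow> 'd::{finite, linorder} params \<Rightarrow> 'd point \<Rightarrow> real" where
  "outcome_prob V n m \<theta> x =
     (\<Sum>i<n. (cmod ((circuit V n \<theta> x *\<^sub>v ket n 0) \<bullet>c ket n (4 * i + m)))\<^sup>2)"

definition qnn_output ::
  "complex mat \<Rightarrow> real \<Rightarrow> nat \<Rightarrow> 'd::{finite, linorder} params \<Rightarrow> 'd point \<Rightarrow> real" where
  "qnn_output V R n \<theta> x =
     R - 2 * R * (outcome_prob V n 1 \<theta> x + outcome_prob V n 2 \<theta> x)"

end

theory Submission
  imports Defs
begin

text \<open>
  Writing \<open>z = b + a \<bullet> x\<close>, block \<open>i\<close> applied to \<open>|00\<rangle>\<close> gives outcomes 1 and 2 with total probability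
  \<open>(1 - cos \<gamma> cos z) / 2\<close>, so the output is \<open>R / n\<close> times the sum of \<open>cos \<gamma>\<^sub>i cos (b\<^sub>i + a\<^sub>i \<bullet> x)\<close>; with
  \<open>\<gamma>\<^sub>i = arccos (c\<^sub>i / C)\<close> and \<open>R = n C\<close>, every real trigonometric polynomial is such an output.

  Trigonometric polynomials are dense in \<open>L\<^sup>2(\<mu>)\<close>:
  the bounded functions in their \<open>L\<^sup>2\<close>-closure are closed under products and
  bounded pointwise limits, so the sets with indicator in the closure form a \<open>\<sigma>\<close>-algebra. By
  Weierstrass it contains \<open>{sin ((x \<bullet> v - c) / k) > 0}\<close>, hence in the limit \<open>k \<rightarrow> \<infinity>\<close> all half-spaces,
  hence all Borel sets; simple functions then give all of \<open>L\<^sup>2(\<mu>)\<close>.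
\<close>

section \<open>Density of trigonometric polynomials\<close>

text \<open>The generators are exactly the terms that one block of the circuit can produce up to
  scaling. Constants (zero frequency) and sines (phase shifted by \<open>pi / 2\<close>) are special
  cases.\<close>

inductive trig_poly :: "('a::real_inner \<Rightarrow> real) \<Rightarrow> bool" where
  cos: "trig_poly (\<lambda>x. c * cos (b + a \<bullet> x))"
| add: "trig_poly p \<Longrightarrow> trig_poly q \<Longrightarrow> trig_poly (\<lambda>x. p x + q x)"

lemma trig_poly_const: "trig_poly (\<lambda>x. c)"
  using trig_poly.cos[of c 0 0] by simp

lemma trig_poly_sin: "trig_poly (\<lambda>x. sin (b + a \<bullet> x))"
proof -
  have "1 * cos ((b - pi / 2) + a \<bullet> x) = sin (b + a \<bullet> x)" for x
  proof -
    have "(b - pi / 2) + a \<bullet> x = (b + a \<bullet> x) - pi / 2" by simp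
    then show ?thesis by (simp only: cos_diff) simp
  qed
  then show ?thesis using trig_poly.cos[of 1 "b - pi / 2" a] by simp
qed

lemma trig_poly_scale: "trig_poly p \<Longrightarrow> trig_poly (\<lambda>x. k * p x)"
proof (induction rule: trig_poly.induct)
  case (cos c b a)
  then show ?case using trig_poly.cos[of "k * c" b a] by (simp add: mult.assoc)
next
  case (add p q)
  then show ?case using trig_poly.add[OF add.IH] by (simp add: distrib_left)
qed

text \<open>Product-to-sum formula: phases and frequencies are added and subtracted. One cosine
  factor suffices here, since \<open>approximable_mult_bounded\<close> handles general products by
  induction on the trigonometric factor.\<close>

lemma trig_poly_mult_cos:
  assumes "trig_poly p" shows "trig_poly (\<lambda>x. p x * (c * cos (b + a \<bullet> x)))"
  using assms
proof (induction rule: trig_poly.induct)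
  case (cos c' b' a')
  have eq: "c' * cos (b' + a' \<bullet> x) * (c * cos (b + a \<bullet> x)) =
    (c' * c / 2) * cos ((b' - b) + (a' - a) \<bullet> x) + (c' * c / 2) * cos ((b' + b) + (a' + a) \<bullet> x)" for x
  proof -
    have "(b' - b) + (a' - a) \<bullet> x = (b' + a' \<bullet> x) - (b + a \<bullet> x)"
      "(b' + b) + (a' + a) \<bullet> x = (b' + a' \<bullet> x) + (b + a \<bullet> x)"
      by (simp_all add: algebra_simps)
    then show ?thesis by (simp only: cos_diff cos_add) (simp add: algebra_simps)
  qed
  show ?case unfolding eq by (intro trig_poly.intros)
next
  case (add p q)
  then show ?case using trig_poly.add[OF add.IH] by (simp add: distrib_right)
qed

lemma trig_poly_borel:
  fixes p :: "'a::euclidean_space \<Rightarrow> real"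
  shows "trig_poly p \<Longrightarrow> p \<in> borel_measurable borel"
  by (induction rule: trig_poly.induct) auto

lemma trig_poly_bounded:
  "trig_poly p \<Longrightarrow> \<exists>B. \<forall>x. \<bar>p x\<bar> \<le> B"
proof (induction rule: trig_poly.induct)
  case (cos c b a)
  have "\<bar>c * cos (b + a \<bullet> x)\<bar> \<le> \<bar>c\<bar>" for x
    by (simp add: abs_mult mult_left_le)
  then show ?case by blast
next
  case (add p q)
  then obtain B C where "\<bar>p x\<bar> \<le> B" "\<bar>q x\<bar> \<le> C" for x by blast
  then have "\<bar>p x + q x\<bar> \<le> B + C" for x
    by (meson abs_triangle_ineq add_mono order_trans)
  then show ?case by blast
qed

text \<open>Flattens the inductive form into families of parameters, one index per circuit block;
  \<open>n \<ge> 1\<close> because the circuit needs at least one block.\<close>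

lemma trig_poly_sum_cos:
  "trig_poly p \<Longrightarrow> \<exists>n\<ge>1::nat. \<exists>c b a. \<forall>x. p x = (\<Sum>i<n. c i * cos (b i + a i \<bullet> x))"
proof (induction rule: trig_poly.induct)
  case (cos c b a)
  show ?case
  proof (intro exI conjI allI)
    show "c * cos (b + a \<bullet> x) = (\<Sum>i<1::nat. c * cos (b + a \<bullet> x))" for x by simp
  qed simp
next
  case (add p q)
  then obtain n c b a where n: "n \<ge> (1::nat)"
    and p: "\<And>x. p x = (\<Sum>i<n. c i * cos (b i + a i \<bullet> x))" by blast
  from add.IH(2) obtain n' :: nat and c' b' a' where
    q: "\<And>x. q x = (\<Sum>i<n'. c' i * cos (b' i + a' i \<bullet> x))" by blast
  \<comment> \<open>Concatenation of two parameter families, the second one shifted by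
    \<open>n\<close>.\<close>
  let ?j = "\<lambda>u v i. if i < n then u i else v (i - n)"
  have split: "(\<Sum>i<n + k. F i) = (\<Sum>i<n. F i) + (\<Sum>i<k. F (n + i))" for F :: "nat \<Rightarrow> real" and k
    by (induction k) auto
  show ?case
  proof (intro exI conjI allI)
    show "n + n' \<ge> 1" using n by simp
    show "p x + q x = (\<Sum>i<n + n'. ?j c c' i * cos (?j b b' i + ?j a a' i \<bullet> x))" for x
      unfolding p q split by simp
  qed
qed

section \<open>Elementary estimates for square-integrable functions\<close>

text \<open>A root-free substitute for the Minkowski inequality: the square of a sum is at most
  twice the sum of the squares, because the square of the difference is nonnegative.\<close>

lemma sq_integrable_add:
  fixes f g :: "'a \<Rightarrow> real"
  assumes [measurable]: "f \<in> borel_measurable M" "g \<in> borel_measurable M"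
    and f: "integrable M (\<lambda>x. (f x)\<^sup>2)" and g: "integrable M (\<lambda>x. (g x)\<^sup>2)"
  shows "integrable M (\<lambda>x. (f x + g x)\<^sup>2)"
    and "(\<integral>x. (f x + g x)\<^sup>2 \<partial>M) \<le> 2 * (\<integral>x. (f x)\<^sup>2 \<partial>M) + 2 * (\<integral>x. (g x)\<^sup>2 \<partial>M)"
proof -
  have le: "(f x + g x)\<^sup>2 \<le> 2 * (f x)\<^sup>2 + 2 * (g x)\<^sup>2" for x
    using zero_le_power2[of "f x - g x"] by (simp add: power2_eq_square algebra_simps)
  have i: "integrable M (\<lambda>x. 2 * (f x)\<^sup>2 + 2 * (g x)\<^sup>2)" using f g by simp
  show int: "integrable M (\<lambda>x. (f x + g x)\<^sup>2)"
    by (rule Bochner_Integration.integrable_bound[OF i]) (use le in \<open>auto simp: abs_of_nonneg\<close>)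
  have "(\<integral>x. (f x + g x)\<^sup>2 \<partial>M) \<le> (\<integral>x. 2 * (f x)\<^sup>2 + 2 * (g x)\<^sup>2 \<partial>M)"
    by (rule integral_mono[OF int i le])
  then show "(\<integral>x. (f x + g x)\<^sup>2 \<partial>M) \<le> 2 * (\<integral>x. (f x)\<^sup>2 \<partial>M) + 2 * (\<integral>x. (g x)\<^sup>2 \<partial>M)"
    using f g by simp
qed

lemma sq_integrable_diff:
  fixes f g :: "'a \<Rightarrow> real"
  assumes "f \<in> borel_measurable M" "g \<in> borel_measurable M"
    and "integrable M (\<lambda>x. (f x)\<^sup>2)" "integrable M (\<lambda>x. (g x)\<^sup>2)"
  shows "integrable M (\<lambda>x. (f x - g x)\<^sup>2)"
  using sq_integrable_add(1)[of f M "\<lambda>x. - g x"] assms by simp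

lemma sq_integrable_mult_bounded:
  fixes f g :: "'a \<Rightarrow> real"
  assumes [measurable]: "f \<in> borel_measurable M" "g \<in> borel_measurable M"
    and f: "integrable M (\<lambda>x. (f x)\<^sup>2)" and g: "\<And>x. \<bar>g x\<bar> \<le> B"
  shows "integrable M (\<lambda>x. (f x * g x)\<^sup>2)"
    and "(\<integral>x. (f x * g x)\<^sup>2 \<partial>M) \<le> B\<^sup>2 * (\<integral>x. (f x)\<^sup>2 \<partial>M)"
proof -
  have le: "(f x * g x)\<^sup>2 \<le> B\<^sup>2 * (f x)\<^sup>2" for x
    using mult_left_mono[OF abs_le_square_iff[THEN iffD1, of "g x" B] zero_le_power2[of "f x"]] g[of x]
    by (simp add: power_mult_distrib mult.commute)
  have i: "integrable M (\<lambda>x. B\<^sup>2 * (f x)\<^sup>2)" using f by simp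
  show int: "integrable M (\<lambda>x. (f x * g x)\<^sup>2)"
    by (rule Bochner_Integration.integrable_bound[OF i]) (use le in \<open>auto simp: abs_of_nonneg\<close>)
  have "(\<integral>x. (f x * g x)\<^sup>2 \<partial>M) \<le> (\<integral>x. B\<^sup>2 * (f x)\<^sup>2 \<partial>M)"
    by (rule integral_mono[OF int i le])
  then show "(\<integral>x. (f x * g x)\<^sup>2 \<partial>M) \<le> B\<^sup>2 * (\<integral>x. (f x)\<^sup>2 \<partial>M)" by simp
qed

section \<open>The closure of the trigonometric polynomials in L2\<close>

locale finite_borel = finite_measure M for M :: "'a::euclidean_space measure" +
  assumes sets_M: "sets M = sets borel"
begin

lemma space_M: "space M = UNIV"
  using sets_eq_imp_space_eq[OF sets_M] by simp

text \<open>Membership in the L2-closure, measured by the squared distance. Square-integrability is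
  demanded explicitly, since a Bochner integral that does not exist is 0 and would make the estimate
  vacuous.\<close>

definition approximable :: "('a \<Rightarrow> real) \<Rightarrow> bool" where
  "approximable h \<longleftrightarrow> h \<in> borel_measurable M \<and> integrable M (\<lambda>x. (h x)\<^sup>2) \<and>
     (\<forall>e>0. \<exists>p. trig_poly p \<and> (\<integral>x. (h x - p x)\<^sup>2 \<partial>M) < e)"

lemma trig_poly_measurable: "trig_poly p \<Longrightarrow> p \<in> borel_measurable M"
  using trig_poly_borel sets_M measurable_cong_sets by blast

lemma bounded_sq_integrable:
  fixes h :: "'a \<Rightarrow> real"
  assumes "h \<in> borel_measurable M" "\<And>x. \<bar>h x\<bar> \<le> B"
  shows "integrable M (\<lambda>x. (h x)\<^sup>2)"
  \<comment> \<open>The constant 1 is square-integrable because the measure is finite;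
    \<open>h\<close> is the bounded factor.\<close>
  using sq_integrable_mult_bounded(1)[of "\<lambda>_. 1" M h B] assms by simp

lemma trig_poly_sq_integrable: "trig_poly p \<Longrightarrow> integrable M (\<lambda>x. (p x)\<^sup>2)"
  using trig_poly_bounded[of p] bounded_sq_integrable trig_poly_measurable by blast

text \<open>Closing twice gives nothing new, so approximants may themselves be merely
  approximable.\<close>

lemma approximable_closed:
  assumes h: "h \<in> borel_measurable M" "integrable M (\<lambda>x. (h x)\<^sup>2)"
    and ex: "\<And>e. e > 0 \<Longrightarrow> \<exists>g. approximable g \<and> (\<integral>x. (h x - g x)\<^sup>2 \<partial>M) < e"
  shows "approximable h"
  unfolding approximable_def
proof (intro conjI allI impI h)
  fix e :: real assume "e > 0"
  \<comment> \<open>Two errors below \<open>e / 4\<close>, each doubled by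
    \<open>sq_integrable_add\<close>, stay below \<open>e\<close>.\<close>
  then have e4: "e / 4 > 0" by simp
  from ex[OF e4] obtain g where g: "approximable g" "(\<integral>x. (h x - g x)\<^sup>2 \<partial>M) < e / 4" by blast
  with e4 obtain p where p: "trig_poly p" "(\<integral>x. (g x - p x)\<^sup>2 \<partial>M) < e / 4"
    unfolding approximable_def by blast
  have gm: "g \<in> borel_measurable M" "integrable M (\<lambda>x. (g x)\<^sup>2)"
    using g unfolding approximable_def by auto
  have "(\<integral>x. (h x - p x)\<^sup>2 \<partial>M) = (\<integral>x. ((h x - g x) + (g x - p x))\<^sup>2 \<partial>M)" by simp
  also have "\<dots> \<le> 2 * (\<integral>x. (h x - g x)\<^sup>2 \<partial>M) + 2 * (\<integral>x. (g x - p x)\<^sup>2 \<partial>M)"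
    using h gm trig_poly_measurable[OF p(1)] trig_poly_sq_integrable[OF p(1)]
    by (intro sq_integrable_add sq_integrable_diff borel_measurable_diff)
  finally show "\<exists>p. trig_poly p \<and> (\<integral>x. (h x - p x)\<^sup>2 \<partial>M) < e" using g(2) p by force
qed

lemma approximable_trig_poly: "trig_poly p \<Longrightarrow> approximable p"
  unfolding approximable_def
  using trig_poly_measurable trig_poly_sq_integrable by (auto intro!: exI[of _ p])

lemma approximable_add:
  assumes "approximable f" "approximable g"
  shows "approximable (\<lambda>x. f x + g x)"
proof -
  have f: "f \<in> borel_measurable M" "integrable M (\<lambda>x. (f x)\<^sup>2)"
    and g: "g \<in> borel_measurable M" "integrable M (\<lambda>x. (g x)\<^sup>2)"
    using assms unfolding approximable_def by auto
  show ?thesis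
    unfolding approximable_def
  proof (intro conjI allI impI)
    fix e :: real assume "e > 0"
    then have e4: "e / 4 > 0" by simp
    from e4 assms(1) obtain p where p: "trig_poly p" "(\<integral>x. (f x - p x)\<^sup>2 \<partial>M) < e / 4"
      unfolding approximable_def by blast
    from e4 assms(2) obtain q where q: "trig_poly q" "(\<integral>x. (g x - q x)\<^sup>2 \<partial>M) < e / 4"
      unfolding approximable_def by blast
    have "(\<integral>x. (f x + g x - (p x + q x))\<^sup>2 \<partial>M) = (\<integral>x. ((f x - p x) + (g x - q x))\<^sup>2 \<partial>M)"
      by (simp add: algebra_simps)
    also have "\<dots> \<le> 2 * (\<integral>x. (f x - p x)\<^sup>2 \<partial>M) + 2 * (\<integral>x. (g x - q x)\<^sup>2 \<partial>M)"
      using f g p q trig_poly_measurable trig_poly_sq_integrable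
      by (intro sq_integrable_add sq_integrable_diff borel_measurable_diff) auto
    finally show "\<exists>p. trig_poly p \<and> (\<integral>x. (f x + g x - p x)\<^sup>2 \<partial>M) < e"
      using p q by (intro exI[of _ "\<lambda>x. p x + q x"]) (auto intro: trig_poly.add)
  qed (use f g sq_integrable_add(1)[of f M g] in auto)
qed

text \<open>Replacing \<open>f\<close> by a trigonometric polynomial \<open>p\<close> costs at most
  the squared bound of \<open>g\<close> times the squared error. What remains is
  \<open>g * p\<close>, which splits into products of \<open>g\<close> with single cosines.\<close>

lemma approximable_mult_bounded:
  assumes "approximable f" "approximable g" and B: "\<And>x. \<bar>g x\<bar> \<le> B"
  shows "approximable (\<lambda>x. f x * g x)"
proof -
  have f: "f \<in> borel_measurable M" "integrable M (\<lambda>x. (f x)\<^sup>2)"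
    and g: "g \<in> borel_measurable M" "integrable M (\<lambda>x. (g x)\<^sup>2)"
    using assms unfolding approximable_def by auto
  \<comment> \<open>Multiplication by a fixed cosine is bounded on L2 and maps trigonometric
    polynomials to trigonometric polynomials, hence preserves the closure.\<close>
  have mult_cos: "approximable (\<lambda>x. h x * (c * cos (b + a \<bullet> x)))" if h: "approximable h" for h c b a
  proof -
    define t where "t = (\<lambda>x. c * cos (b + a \<bullet> x))"
    have hm: "h \<in> borel_measurable M" "integrable M (\<lambda>x. (h x)\<^sup>2)"
      using h unfolding approximable_def by auto
    have tt: "trig_poly t" unfolding t_def by (rule trig_poly.cos)
    note tm = trig_poly_measurable[OF tt]
    obtain C where C: "\<And>x. \<bar>t x\<bar> \<le> C" using trig_poly_bounded[OF tt] by blast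
    have "approximable (\<lambda>x. h x * t x)"
    proof (rule approximable_closed)
      fix e :: real assume e: "e > 0"
      \<comment> \<open>The summand 1 keeps the denominator positive and the final inequality strict
        even for \<open>C = 0\<close>.\<close>
      define e' where "e' = e / (C\<^sup>2 + 1)"
      have pos: "C\<^sup>2 + 1 > 0" by (simp add: add_nonneg_pos)
      then have e': "e' > 0" "(C\<^sup>2 + 1) * e' = e" using e by (auto simp: e'_def)
      then obtain p where p: "trig_poly p" "(\<integral>x. (h x - p x)\<^sup>2 \<partial>M) < e'"
        using h unfolding approximable_def by blast
      have "(\<integral>x. (h x * t x - p x * t x)\<^sup>2 \<partial>M) = (\<integral>x. ((h x - p x) * t x)\<^sup>2 \<partial>M)"
        by (simp add: algebra_simps)
      also have "\<dots> \<le> C\<^sup>2 * (\<integral>x. (h x - p x)\<^sup>2 \<partial>M)"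
        using hm p tm C trig_poly_measurable trig_poly_sq_integrable
        by (intro sq_integrable_mult_bounded sq_integrable_diff borel_measurable_diff) auto
      also have "\<dots> \<le> C\<^sup>2 * e'" using p by (intro mult_left_mono) auto
      also have "\<dots> < e" using e' by (simp add: distrib_right)
      finally show "\<exists>g. approximable g \<and> (\<integral>x. (h x * t x - g x)\<^sup>2 \<partial>M) < e"
        using approximable_trig_poly[OF trig_poly_mult_cos[OF p(1)]] unfolding t_def by blast
    qed (use hm tm C sq_integrable_mult_bounded(1)[of h M t C] in auto)
    then show ?thesis unfolding t_def .
  qed
  have mult_trig: "approximable (\<lambda>x. h x * p x)" if "trig_poly p" "approximable h" for p h
    using that
  proof (induction rule: trig_poly.induct)
    case (cos c b a)
    then show ?case by (rule mult_cos)
  next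
    case (add p q)
    then show ?case using approximable_add by (simp add: distrib_left)
  qed
  show ?thesis
  proof (rule approximable_closed)
    fix e :: real assume e: "e > 0"
    define e' where "e' = e / (B\<^sup>2 + 1)"
    have pos: "B\<^sup>2 + 1 > 0" by (simp add: add_nonneg_pos)
    then have e': "e' > 0" "(B\<^sup>2 + 1) * e' = e" using e by (auto simp: e'_def)
    then obtain p where p: "trig_poly p" "(\<integral>x. (f x - p x)\<^sup>2 \<partial>M) < e'"
      using assms(1) unfolding approximable_def by blast
    have "(\<integral>x. (f x * g x - g x * p x)\<^sup>2 \<partial>M) = (\<integral>x. ((f x - p x) * g x)\<^sup>2 \<partial>M)"
      by (simp add: algebra_simps)
    also have "\<dots> \<le> B\<^sup>2 * (\<integral>x. (f x - p x)\<^sup>2 \<partial>M)"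
      using f g p B trig_poly_measurable trig_poly_sq_integrable
      by (intro sq_integrable_mult_bounded sq_integrable_diff borel_measurable_diff) auto
    also have "\<dots> \<le> B\<^sup>2 * e'" using p by (intro mult_left_mono) auto
    also have "\<dots> < e" using e' by (simp add: distrib_right)
    finally show "\<exists>h. approximable h \<and> (\<integral>x. (f x * g x - h x)\<^sup>2 \<partial>M) < e"
      using mult_trig[OF p(1) assms(2)] by blast
  qed (use f g B sq_integrable_mult_bounded(1)[of f M g B] in auto)
qed

lemma approximable_const: "approximable (\<lambda>x. c)"
  by (intro approximable_trig_poly trig_poly_const)

lemma approximable_scale: "approximable f \<Longrightarrow> approximable (\<lambda>x. c * f x)"
  using approximable_mult_bounded[OF _ approximable_const, of f c "\<bar>c\<bar>"] by (simp add: mult.commute)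

lemma approximable_sum:
  "finite I \<Longrightarrow> (\<And>i. i \<in> I \<Longrightarrow> approximable (f i)) \<Longrightarrow> approximable (\<lambda>x. \<Sum>i\<in>I. f i x)"
  by (induction rule: finite_induct) (auto intro: approximable_add approximable_const)

text \<open>Dominated convergence: both \<open>h\<close> and \<open>s i\<close> are bounded by
  \<open>w\<close>, so the squared difference is dominated by \<open>4 * w^2\<close>. The bound
  \<open>w\<close> is a function so that unbounded limits are covered at the end.\<close>

lemma approximable_lim:
  assumes s: "\<And>i::nat. approximable (s i)" and lim: "\<And>x. (\<lambda>i. s i x) \<longlonglongrightarrow> h x"
    and w: "w \<in> borel_measurable M" "integrable M (\<lambda>x. (w x)\<^sup>2)" and le: "\<And>i x. \<bar>s i x\<bar> \<le> w x"
  shows "approximable h"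
proof (rule approximable_closed)
  have sm[measurable]: "s i \<in> borel_measurable M" for i using s unfolding approximable_def by auto
  show hm[measurable]: "h \<in> borel_measurable M"
    by (rule borel_measurable_LIMSEQ_real[OF _ sm]) (rule lim)
  have hw: "\<bar>h x\<bar> \<le> w x" for x
    using tendsto_rabs[OF lim[of x]] le[of _ x] by (intro LIMSEQ_le_const2) auto
  show "integrable M (\<lambda>x. (h x)\<^sup>2)"
  proof (rule Bochner_Integration.integrable_bound[OF w(2)])
    have "(h x)\<^sup>2 \<le> (w x)\<^sup>2" for x using hw[of x] by (intro abs_le_square_iff[THEN iffD1]) auto
    then show "AE x in M. norm ((h x)\<^sup>2) \<le> norm ((w x)\<^sup>2)" by simp
  qed simp
  have "(\<lambda>i. \<integral>x. (h x - s i x)\<^sup>2 \<partial>M) \<longlonglongrightarrow> (\<integral>x. 0 \<partial>M)"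
  proof (rule integral_dominated_convergence)
    show "integrable M (\<lambda>x. 4 * (w x)\<^sup>2)" using w by simp
    show "AE x in M. (\<lambda>i. (h x - s i x)\<^sup>2) \<longlonglongrightarrow> 0"
    proof (rule AE_I2)
      fix x
      show "(\<lambda>i. (h x - s i x)\<^sup>2) \<longlonglongrightarrow> 0"
        using tendsto_power[OF tendsto_diff[OF tendsto_const[of "h x"] lim[of x]], of 2] by simp
    qed
    show "AE x in M. norm ((h x - s i x)\<^sup>2) \<le> 4 * (w x)\<^sup>2" for i
    proof (rule AE_I2)
      fix x
      have "\<bar>h x - s i x\<bar> \<le> 2 * w x" using hw[of x] le[of i x] by linarith
      then have "(h x - s i x)\<^sup>2 \<le> (2 * w x)\<^sup>2" by (intro abs_le_square_iff[THEN iffD1]) auto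
      then show "norm ((h x - s i x)\<^sup>2) \<le> 4 * (w x)\<^sup>2" by (simp add: power_mult_distrib)
    qed
  qed auto
  then have "(\<lambda>i. \<integral>x. (h x - s i x)\<^sup>2 \<partial>M) \<longlonglongrightarrow> 0" by simp
  then have ev: "eventually (\<lambda>i. (\<integral>x. (h x - s i x)\<^sup>2 \<partial>M) < e) sequentially" if "e > 0" for e
    using that by (rule order_tendstoD)
  show "\<exists>g. approximable g \<and> (\<integral>x. (h x - g x)\<^sup>2 \<partial>M) < e" if e: "e > 0" for e
  proof -
    obtain i where "(\<integral>x. (h x - s i x)\<^sup>2 \<partial>M) < e"
      using eventually_happens'[OF sequentially_bot ev[OF e]] by blast
    with s[of i] show ?thesis by blast
  qed
qed

lemma approximable_bounded_lim:
  assumes "\<And>i::nat. approximable (s i)" "\<And>x. (\<lambda>i. s i x) \<longlonglongrightarrow> h x" "\<And>i x. \<bar>s i x\<bar> \<le> B"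
  shows "approximable h"
  by (rule approximable_lim[OF assms(1,2) _ _ assms(3)]) auto

section \<open>From polynomials to indicators of Borel sets\<close>

text \<open>Boundedness is carried through the induction because the product case needs a bounded
  factor.\<close>

lemma approximable_real_polynomial:
  fixes y :: "'a \<Rightarrow> real"
  assumes "real_polynomial_function q" and y: "approximable y" "\<And>x. \<bar>y x\<bar> \<le> 1"
  shows "approximable (\<lambda>x. q (y x)) \<and> (\<exists>B. \<forall>x. \<bar>q (y x)\<bar> \<le> B)"
  using assms(1)
proof (induction rule: real_polynomial_function.induct)
  case (linear f)
  then obtain c where f: "f = (\<lambda>x. x * c)" unfolding real_bounded_linear by blast
  have "\<bar>f (y x)\<bar> \<le> \<bar>c\<bar>" for x
    using y(2)[of x] mult_right_mono[of "\<bar>y x\<bar>" 1 "\<bar>c\<bar>"] by (simp add: f abs_mult)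
  then show ?case using approximable_scale[OF y(1), of c] by (auto simp: f mult.commute)
next
  case (const c)
  then show ?case using approximable_const by auto
next
  case (add f g)
  then obtain B C where "\<bar>f (y x)\<bar> \<le> B" "\<bar>g (y x)\<bar> \<le> C" for x by blast
  then have "\<bar>f (y x) + g (y x)\<bar> \<le> B + C" for x
    by (meson abs_triangle_ineq add_mono order_trans)
  then show ?case using add approximable_add by blast
next
  case (mult f g)
  then obtain B C where B: "\<bar>f (y x)\<bar> \<le> B" and C: "\<bar>g (y x)\<bar> \<le> C" for x by blast
  then have "\<bar>f (y x) * g (y x)\<bar> \<le> B * C" for x
    unfolding abs_mult by (intro mult_mono) (auto intro: order_trans[OF abs_ge_zero])
  moreover have "approximable (\<lambda>x. f (y x) * g (y x))"
    using mult C by (intro approximable_mult_bounded) auto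
  ultimately show ?case by blast
qed

text \<open>Continuous ramps converge pointwise to the indicator of the positive reals. Weierstrass
  replaces each ramp by a polynomial on \<open>{-1..1}\<close>, which contains the range of
  \<open>y\<close>.\<close>

lemma approximable_indicator_pos:
  fixes y :: "'a \<Rightarrow> real"
  assumes y: "approximable y" "\<And>x. \<bar>y x\<bar> \<le> 1"
  shows "approximable (indicator {x. y x > 0})"
proof -
  \<comment> \<open>The ramp is 0 for \<open>t \<le> 0\<close> and 1 from \<open>t = 1 / n\<close>
    on, so at each fixed \<open>t\<close> it is eventually constant.\<close>
  define \<phi> where "\<phi> = (\<lambda>n t. min 1 (max 0 (real n * t)))"
  have "\<exists>q. real_polynomial_function q \<and> (\<forall>t\<in>{-1..1}. \<bar>\<phi> n t - q t\<bar> < inverse (real (Suc n)))" for n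
  proof -
    have "compact {-1..1::real}" "continuous_on {-1..1} (\<phi> n)" "0 < inverse (real (Suc n))"
      unfolding \<phi>_def by (auto intro!: continuous_intros)
    from Stone_Weierstrass_real_polynomial_function[OF this] show ?thesis by metis
  qed
  then obtain q where q: "\<And>n. real_polynomial_function (q n)"
    and qt: "\<And>n t. t \<in> {-1..1} \<Longrightarrow> \<bar>\<phi> n t - q n t\<bar> < inverse (real (Suc n))" by metis
  have qy: "\<bar>\<phi> n (y x) - q n (y x)\<bar> < inverse (real (Suc n))" for n x
    using y(2)[of x] by (intro qt) auto
  show ?thesis
  proof (rule approximable_bounded_lim)
    show "approximable (\<lambda>x. q n (y x))" for n
      using approximable_real_polynomial[OF q y] by blast
    \<comment> \<open>The ramp is at most 1, and the polynomial errs by at most 1.\<close>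
    show "\<bar>q n (y x)\<bar> \<le> 2" for n x
    proof -
      have "inverse (real (Suc n)) \<le> 1" by (simp add: field_simps)
      moreover have "\<bar>\<phi> n (y x)\<bar> \<le> 1" unfolding \<phi>_def by auto
      ultimately show ?thesis using qy[of n x] by linarith
    qed
    fix x
    have lim: "(\<lambda>n. \<phi> n (y x)) \<longlonglongrightarrow> indicator {x. y x > 0} x"
    proof (cases "y x > 0")
      case True
      then obtain N where N: "real N * y x > 1" using reals_Archimedean3 by blast
      have "\<phi> n (y x) = 1" if "n \<ge> N" for n
      proof -
        have "real N * y x \<le> real n * y x" using that True by simp
        then show ?thesis using N unfolding \<phi>_def by linarith
      qed
      then have "eventually (\<lambda>n. \<phi> n (y x) = 1) sequentially" using eventually_sequentially by blast
      then show ?thesis using True by (simp add: tendsto_eventually)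
    next
      case False
      then have "real n * y x \<le> 0" for n by (simp add: mult_nonneg_nonpos)
      then have "\<phi> n (y x) = 0" for n by (simp add: \<phi>_def max_absorb1)
      then show ?thesis using False by simp
    qed
    have "(\<lambda>n. \<phi> n (y x) - q n (y x)) \<longlonglongrightarrow> 0"
    proof (rule Lim_null_comparison[OF always_eventually LIMSEQ_inverse_real_of_nat], rule allI)
      show "norm (\<phi> n (y x) - q n (y x)) \<le> inverse (real (Suc n))" for n
        unfolding real_norm_def using qy[of n x] by (rule less_imp_le)
    qed
    from tendsto_diff[OF lim this] show "(\<lambda>n. q n (y x)) \<longlonglongrightarrow> indicator {x. y x > 0} x"
      by simp
  qed
qed

text \<open>The sine has the sign of its argument on the interval from \<open>-pi\<close> to
  \<open>pi\<close>. Dividing by \<open>Suc n\<close> brings the argument at a fixed point into it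
  for all large \<open>n\<close>, so the indicators are eventually constant there.\<close>

lemma approximable_indicator_halfspace:
  "approximable (indicator {x. c < x \<bullet> v})"
proof (rule approximable_bounded_lim)
  define y where "y = (\<lambda>n::nat. \<lambda>x. sin ((x \<bullet> v - c) / real (Suc n)))"
  show "approximable (indicator {x. y n x > 0})" for n
  proof (rule approximable_indicator_pos)
    show "approximable (y n)"
      using trig_poly_sin[of "- c / real (Suc n)" "v /\<^sub>R real (Suc n)"]
      by (intro approximable_trig_poly) (simp add: y_def inner_commute[of v] divide_inverse algebra_simps)
  qed (simp add: y_def)
  show "\<bar>indicator {x. y n x > 0} x\<bar> \<le> (1::real)" for n x by (simp add: indicator_def)
  fix x
  define t where "t = x \<bullet> v - c"
  obtain N where N: "real N > \<bar>t\<bar>" using reals_Archimedean2 by blast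
  have "y n x > 0 \<longleftrightarrow> t > 0" if "n \<ge> N" for n
  proof -
    have s: "\<bar>t / real (Suc n)\<bar> < pi"
    proof -
      have "\<bar>t / real (Suc n)\<bar> \<le> 1" using N that by (simp add: abs_divide field_simps)
      then show ?thesis using pi_gt3 by linarith
    qed
    show ?thesis
    proof (cases "t > 0")
      case True
      then have "0 < t / real (Suc n)" by simp
      then show ?thesis using True s sin_gt_zero[of "t / real (Suc n)"] unfolding y_def t_def by simp
    next
      case False
      then have "t / real (Suc n) \<le> 0" by (simp add: divide_nonpos_pos)
      then have "sin (t / real (Suc n)) \<le> 0"
        using s sin_ge_zero[of "- (t / real (Suc n))"] by (simp only: sin_minus) linarith
      then show ?thesis using False unfolding y_def t_def by linarith
    qed
  qed
  then have "eventually (\<lambda>n. (indicator {x. y n x > 0} x :: real) = indicator {x. c < x \<bullet> v} x) sequentially"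
    unfolding eventually_sequentially t_def by (intro exI[of _ N]) (auto simp: indicator_def)
  then show "(\<lambda>n. indicator {x. y n x > 0} x :: real) \<longlonglongrightarrow> indicator {x. c < x \<bullet> v} x"
    by (rule tendsto_eventually)
qed

lemma approximable_indicator_Compl:
  assumes "approximable (indicator A)" shows "approximable (indicator (- A))"
proof -
  have "approximable (\<lambda>x. 1 + (- 1) * indicator A x)"
    by (intro approximable_add approximable_const approximable_scale assms)
  moreover have "(\<lambda>x. 1 + (- 1) * indicator A x :: real) = indicator (- A)"
    by (auto simp: indicator_def)
  ultimately show ?thesis by simp
qed

text \<open>De Morgan: the product of the indicators of the complements is the indicator of the
  complement of the union.\<close>

lemma approximable_indicator_Un:
  assumes "approximable (indicator A)" "approximable (indicator B)"
  shows "approximable (indicator (A \<union> B))"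
proof -
  have "approximable (\<lambda>x. indicator (- A) x * indicator (- B) x)"
    using assms by (intro approximable_mult_bounded[where B = 1] approximable_indicator_Compl)
      (auto simp: indicator_def)
  moreover have "(\<lambda>x. indicator (- A) x * indicator (- B) x :: real) = indicator (- (A \<union> B))"
    by (auto simp: indicator_def)
  ultimately show ?thesis using approximable_indicator_Compl[of "- (A \<union> B)"] by simp
qed

text \<open>Induction over the sigma-algebra generated by coordinate half-spaces. A countable union
  is the bounded limit of its finite partial unions, so no disjointness is required.\<close>

lemma approximable_indicator:
  assumes "A \<in> sets borel" shows "approximable (indicator A)"
proof -
  have "A \<in> sigma_sets UNIV ((\<lambda>(a, i). {x::'a. a < x \<bullet> i}) ` (UNIV \<times> Basis))"
    using assms by (subst (asm) borel_eq_halfspace_greater) simp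
  then show ?thesis
  proof (induction rule: sigma_sets.induct)
    case (Basic a)
    then show ?case using approximable_indicator_halfspace by auto
  next
    case Empty
    then show ?case using approximable_const[of 0] by (simp add: indicator_def[abs_def])
  next
    case (Compl a)
    then show ?case using approximable_indicator_Compl by (simp add: Compl_eq_Diff_UNIV)
  next
    case (Union a)
    have fin: "approximable (indicator (\<Union>i<k. a i))" for k
    proof (induction k)
      case 0
      then show ?case using approximable_const[of 0] by (simp add: indicator_def[abs_def])
    next
      case (Suc k)
      then show ?case using approximable_indicator_Un[OF Union.IH[of k] Suc]
        by (simp add: lessThan_Suc)
    qed
    show ?case
      by (rule approximable_bounded_lim[OF fin LIMSEQ_indicator_UN, of 1]) (simp add: indicator_def)
  qed
qed

lemma approximable_square_integrable:
  assumes "f \<in> borel_measurable M" "integrable M (\<lambda>x. (f x)\<^sup>2)"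
  shows "approximable f"
proof -
  \<comment> \<open>The centre 0 turns the distance bound into \<open>2 * \<bar>f x\<bar>\<close>,
    the square-integrable dominating function for \<open>approximable_lim\<close>.\<close>
  from borel_measurable_implies_sequence_metric[OF assms(1), of 0] space_M obtain s where
    s: "\<And>i. simple_function M (s i)" and lim: "\<And>x. (\<lambda>i. s i x) \<longlonglongrightarrow> f x"
    and le: "\<And>i x. \<bar>s i x\<bar> \<le> 2 * \<bar>f x\<bar>" by auto
  have "approximable (s i)" for i
  proof -
    have fin: "finite (range (s i))" using s[of i] space_M unfolding simple_function_def by simp
    have set: "s i -` {y} \<in> sets borel" for y
      using simple_functionD(2)[OF s[of i], of "{y}"] space_M sets_M by simp
    have "approximable (\<lambda>x. \<Sum>y\<in>range (s i). y * indicator (s i -` {y}) x)"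
      by (intro approximable_sum approximable_scale approximable_indicator fin set)
    moreover have "(\<Sum>y\<in>range (s i). y * indicator (s i -` {y}) x) = s i x" for x
    proof -
      have "(\<Sum>y\<in>range (s i). y * indicator (s i -` {y}) x) = (\<Sum>y\<in>range (s i). if y = s i x then y else 0)"
        by (intro sum.cong) (auto simp: indicator_def)
      then show ?thesis using fin by simp
    qed
    ultimately show ?thesis by simp
  qed
  then show ?thesis
    by (rule approximable_lim[OF _ lim _ _ le]) (use assms in \<open>auto simp: power_mult_distrib\<close>)
qed

end

section \<open>The output of the circuit\<close>

lemma Rz_gate_mult: "Rz_gate \<alpha> * Rz_gate \<beta> = Rz_gate (\<alpha> + \<beta>)"
  unfolding Rz_gate_def
  by (rule eq_matI)
    (auto simp: mat_of_rows_list_def scalar_prod_def less_Suc_eq numeral_2_eq_2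
      exp_add[symmetric] algebra_simps add_divide_distrib)

lemma Rz_gate_0: "Rz_gate 0 = 1\<^sub>m 2"
  unfolding Rz_gate_def
  by (rule eq_matI) (auto simp: mat_of_rows_list_def less_Suc_eq numeral_2_eq_2)

text \<open>The gates \<open>Rz_gate\<close> form a one-parameter group, so the product is one
  rotation by the summed angle.\<close>

lemma encoding_gates_eq: "encoding_gates a x = Rz_gate (- (a \<bullet> x))"
proof -
  have fold: "foldr (\<lambda>j M. Rz_gate (- (vec_nth a j * vec_nth x j)) * M) js (1\<^sub>m 2) =
      Rz_gate (- (\<Sum>j\<leftarrow>js. vec_nth a j * vec_nth x j))" for js
    by (induction js) (simp_all add: Rz_gate_mult Rz_gate_0)
  have "(\<Sum>j\<leftarrow>rev (sorted_list_of_set (UNIV :: 'a set)). vec_nth a j * vec_nth x j) = a \<bullet> x"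
    by (subst sum_list_distinct_conv_sum_set) (simp_all add: inner_vec_def)
  then show ?thesis unfolding encoding_gates_def fold by simp
qed

text \<open>Conjugation by the Hadamard gate turns a rotation about the z-axis into one about the
  x-axis, here by the angle \<open>- (b + a \<bullet> x)\<close>; \<open>z\<close> is the half
  angle.\<close>

lemma U1_gate_eq:
  "U1_gate a b x = (let z = (b + a \<bullet> x) / 2 in
     mat_of_rows_list 2 [[complex_of_real (cos z), \<i> * complex_of_real (sin z)],
                         [\<i> * complex_of_real (sin z), complex_of_real (cos z)]])"
proof -
  define z where "z = (b + a \<bullet> x) / 2"
  \<comment> \<open>Naming the factor lets the simplifier use only \<open>r * r = 1 / 2\<close>
    instead of handling \<open>sqrt 2\<close>.\<close>
  define r where "r = complex_of_real (1 / sqrt 2)"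
  have "r * r = complex_of_real ((1 / sqrt 2) * (1 / sqrt 2))"
    unfolding r_def by (rule of_real_mult[symmetric])
  then have r: "r * r = 1 / 2" by simp
  then have r': "r * (r * w) = w / 2" for w by (simp flip: mult.assoc)
  have Rz: "Rz_gate (- (2 * z)) = mat_of_rows_list 2
      [[complex_of_real (cos z) + \<i> * complex_of_real (sin z), 0],
       [0, complex_of_real (cos z) - \<i> * complex_of_real (sin z)]]"
    unfolding Rz_gate_def using exp_Euler[of "complex_of_real z"] exp_minus_Euler[of "complex_of_real z"]
    by (simp add: cos_of_real sin_of_real)
  have "U1_gate a b x = H_gate * Rz_gate (- (2 * z)) * H_gate"
  proof -
    have "H_gate * Rz_gate (- b) * Rz_gate (- (a \<bullet> x)) = H_gate * (Rz_gate (- b) * Rz_gate (- (a \<bullet> x)))"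
      by (rule assoc_mult_mat[of _ 2 2 _ 2 _ 2])
        (auto simp: H_gate_def Rz_gate_def mat_of_rows_list_def)
    moreover have "- b + - (a \<bullet> x) = - (2 * z)" unfolding z_def by argo
    ultimately show ?thesis unfolding U1_gate_def encoding_gates_eq Rz_gate_mult by simp
  qed
  also have "\<dots> = mat_of_rows_list 2 [[complex_of_real (cos z), \<i> * complex_of_real (sin z)],
                         [\<i> * complex_of_real (sin z), complex_of_real (cos z)]]"
    unfolding H_gate_def Rz r_def[symmetric]
    by (rule eq_matI)
      (auto simp: mat_of_rows_list_def scalar_prod_def less_Suc_eq numeral_2_eq_2 r r' algebra_simps
        add_divide_distrib diff_divide_distrib)
  finally show ?thesis by (simp add: z_def Let_def)
qed

lemma dim_U1_gate: "dim_row (U1_gate a b x) = 2" "dim_col (U1_gate a b x) = 2"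
  by (simp_all add: U1_gate_eq Let_def mat_of_rows_list_def)

lemma dim_Ry_gate: "dim_row (Ry_gate \<gamma>) = 2" "dim_col (Ry_gate \<gamma>) = 2"
  by (simp_all add: Ry_gate_def mat_of_rows_list_def)

lemma U_block_carrier: "U_block p x \<in> carrier_mat 4 4"
  by (rule carrier_matI) (simp_all add: U_block_def kronecker_def dim_U1_gate dim_Ry_gate split: prod.split)

text \<open>Column 0 is the tensor product of the two first columns, and rows 1 and 2 are the
  outcomes 01 and 10, where the qubits differ. The double-angle formula combines the two
  probabilities.\<close>

lemma U_block_entries:
  "(cmod (U_block (a, b, \<gamma>) x $$ (1, 0)))\<^sup>2 + (cmod (U_block (a, b, \<gamma>) x $$ (2, 0)))\<^sup>2
     = (1 - cos \<gamma> * cos (b + a \<bullet> x)) / 2"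
proof -
  define z g where "z = (b + a \<bullet> x) / 2" and "g = \<gamma> / 2"
  have U1: "U1_gate a b x $$ (0, 0) = complex_of_real (cos z)"
    "U1_gate a b x $$ (Suc 0, 0) = \<i> * complex_of_real (sin z)"
    by (simp_all add: U1_gate_eq Let_def mat_of_rows_list_def z_def)
  have Ry: "Ry_gate \<gamma> $$ (0, 0) = complex_of_real (cos g)" "Ry_gate \<gamma> $$ (Suc 0, 0) = complex_of_real (sin g)"
    by (simp_all add: Ry_gate_def mat_of_rows_list_def g_def)
  have e1: "U_block (a, b, \<gamma>) x $$ (1, 0) = complex_of_real (cos z * sin g)"
    by (simp add: U_block_def kronecker_def dim_U1_gate dim_Ry_gate U1 Ry)
  have e2: "U_block (a, b, \<gamma>) x $$ (2, 0) = \<i> * complex_of_real (sin z * cos g)"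
    by (simp add: U_block_def kronecker_def dim_U1_gate dim_Ry_gate U1 Ry)
  have "(cmod (U_block (a, b, \<gamma>) x $$ (1, 0)))\<^sup>2 + (cmod (U_block (a, b, \<gamma>) x $$ (2, 0)))\<^sup>2
      = (cos z * sin g)\<^sup>2 + (sin z * cos g)\<^sup>2"
    unfolding e1 e2 norm_mult norm_of_real norm_ii by simp
  also have "\<dots> = (cos z)\<^sup>2 * (1 - (cos g)\<^sup>2) + (1 - (cos z)\<^sup>2) * (cos g)\<^sup>2"
    unfolding power_mult_distrib sin_squared_eq ..
  also have "\<dots> = (1 - cos (2 * g) * cos (2 * z)) / 2"
    unfolding cos_double_cos by (simp add: algebra_simps)
  also have "2 * z = b + a \<bullet> x" unfolding z_def by argo
  finally show ?thesis by (simp add: g_def)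
qed

section \<open>State and measurement of the whole circuit\<close>

text \<open>Only columns \<open>4 * k\<close> are treated, since \<open>psi_state\<close> is
  supported there. The last block \<open>C\<close> stands for the identity padding.\<close>

lemma diag_block_mat_4_entry:
  fixes C :: "'a::zero mat"
  assumes "\<And>A. A \<in> set As \<Longrightarrow> A \<in> carrier_mat 4 4"
    and "i < length As" "k < length As" "m < 4"
  shows "diag_block_mat (As @ [C]) $$ (4 * i + m, 4 * k) = (if i = k then (As ! i) $$ (m, 0) else 0)"
  using assms
proof (induction As arbitrary: i k)
  case Nil
  then show ?case by simp
next
  case (Cons A As)
  have A: "dim_row A = 4" "dim_col A = 4" using Cons.prems(1)[of A] by auto
  have As: "map dim_row As = map (\<lambda>_. 4) As" "map dim_col As = map (\<lambda>_. 4) As"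
    using Cons.prems(1) by auto
  let ?D = "diag_block_mat (As @ [C])"
  have dim: "dim_row ?D = 4 * length As + dim_row C" "dim_col ?D = 4 * length As + dim_col C"
    unfolding dim_diag_block_mat by (simp_all add: As sum_list_triv)
  have b: "4 * i + m < 4 + dim_row ?D" "4 * k < 4 + dim_col ?D"
    using Cons.prems(2-4) unfolding dim by auto
  \<comment> \<open>Splits off the first block; \<open>i - 1\<close> and \<open>k - 1\<close> occur
    only where both indices are positive.\<close>
  have "diag_block_mat ((A # As) @ [C]) $$ (4 * i + m, 4 * k) =
      (if i = 0 then if k = 0 then A $$ (m, 0) else 0 else
       if k = 0 then 0 else ?D $$ (4 * (i - 1) + m, 4 * (k - 1)))"
    using b A Cons.prems(4) by (auto simp: Let_def algebra_simps diff_mult_distrib2)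
  also have "\<dots> = (if i = k then ((A # As) ! i) $$ (m, 0) else 0)"
    using Cons.prems by (cases i; cases k) (auto simp: Cons.IH)
  finally show ?case .
qed

lemma psi_state_index:
  assumes "j < circuit_dim n"
  shows "psi_state n $ j = (if \<exists>i<n. j = 4 * i then complex_of_real (1 / sqrt (real n)) else 0)"
proof -
  have car: "(\<lambda>i. ket n (4 * i)) \<in> {..<n} \<rightarrow> carrier_vec (circuit_dim n)"
    by (simp add: ket_def)
  have "finsum_vec TYPE(complex) (circuit_dim n) (\<lambda>i. ket n (4 * i)) {..<n} \<in> carrier_vec (circuit_dim n)"
    using finsum_vec_closed[OF car] .
  then have "psi_state n $ j = complex_of_real (1 / sqrt (real n)) * (\<Sum>i<n. ket n (4 * i) $ j)"
    unfolding psi_state_def using assms by (simp add: index_finsum_vec[OF _ assms car] carrier_vecD)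
  also have "(\<Sum>i<n. ket n (4 * i) $ j) = (\<Sum>i<n. if j = 4 * i then 1 else 0)"
    using assms by (intro sum.cong) (auto simp: ket_def circuit_dim_def unit_vec_def)
  also have "\<dots> = (if \<exists>i<n. j = 4 * i then 1 else 0)"
  proof (cases "\<exists>i<n. j = 4 * i")
    case True
    then obtain k where k: "k < n" "j = 4 * k" by blast
    then have "(\<Sum>i<n. if j = 4 * i then 1 else (0::complex)) = (\<Sum>i<n. if i = k then 1 else 0)"
      by (intro sum.cong) auto
    then show ?thesis using k True by simp
  qed auto
  finally show ?thesis by (auto simp del: of_real_divide)
qed

text \<open>\<open>V\<close> prepares \<open>psi_state\<close>, which feeds the first basis vector
  of every block with equal weight; row \<open>4 * i + m\<close> then meets only its own block.
  Parameters count from 1 and blocks from 0, hence \<open>\<theta> (i + 1)\<close>.\<close>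

lemma circuit_state_index:
  fixes \<theta> :: "'d::{finite, linorder} params"
  assumes V: "prepares_psi n V" and i: "i < n" and m: "m < 4"
  shows "(circuit V n \<theta> x *\<^sub>v ket n 0) $ (4 * i + m) =
    U_block (\<theta> (i + 1)) x $$ (m, 0) * complex_of_real (1 / sqrt (real n))"
proof -
  let ?N = "circuit_dim n" and ?U = "U_mat n \<theta> x"
  define As where "As = map (\<lambda>i. U_block (\<theta> i) x) [1..<n + 1]"
  have As: "\<And>A. A \<in> set As \<Longrightarrow> A \<in> carrier_mat 4 4" "length As = n"
    and nth: "\<And>i. i < n \<Longrightarrow> As ! i = U_block (\<theta> (i + 1)) x"
    using U_block_carrier[of "\<theta> _"] by (auto simp: As_def simp del: upt_Suc)
  have map: "map dim_row As = map (\<lambda>_. 4) As" "map dim_col As = map (\<lambda>_. 4) As"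
    using As by auto
  have U: "?U \<in> carrier_mat ?N ?N"
    unfolding U_mat_def As_def[symmetric] carrier_mat_def
    using As(2) by (simp add: dim_diag_block_mat map sum_list_triv circuit_dim_def)
  have Vc: "V \<in> carrier_mat ?N ?N" and Vp: "V *\<^sub>v ket n 0 = psi_state n"
    using V unfolding prepares_psi_def unitary_mat_def by auto
  have psi: "psi_state n \<in> carrier_vec ?N"
    unfolding Vp[symmetric] using Vc by (simp add: ket_def)
  have r: "4 * i + m < ?N" using i m unfolding circuit_dim_def by simp
  have "circuit V n \<theta> x *\<^sub>v ket n 0 = ?U *\<^sub>v psi_state n"
    unfolding circuit_def Vp[symmetric] using U Vc by (intro assoc_mult_mat_vec) (auto simp: ket_def)
  then have "(circuit V n \<theta> x *\<^sub>v ket n 0) $ (4 * i + m) = (\<Sum>j<?N. ?U $$ (4 * i + m, j) * psi_state n $ j)"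
    using r U psi by (simp add: scalar_prod_def lessThan_atLeast0)
  \<comment> \<open>Outside these indices \<open>psi_state\<close> vanishes, including the padding
    range.\<close>
  also have "\<dots> = (\<Sum>j\<in>(\<lambda>k. 4 * k) ` {..<n}. ?U $$ (4 * i + m, j) * psi_state n $ j)"
    by (rule sum.mono_neutral_right) (auto simp: circuit_dim_def psi_state_index)
  also have "\<dots> = (\<Sum>k<n. ?U $$ (4 * i + m, 4 * k) * psi_state n $ (4 * k))"
    by (subst sum.reindex) (auto simp: inj_on_def)
  also have "\<dots> = (\<Sum>k<n. if k = i then U_block (\<theta> (i + 1)) x $$ (m, 0) * complex_of_real (1 / sqrt (real n)) else 0)"
  proof (intro sum.cong refl)
    fix k assume "k \<in> {..<n}"
    then have k: "k < n" by simp
    have "?U $$ (4 * i + m, 4 * k) = (if i = k then U_block (\<theta> (i + 1)) x $$ (m, 0) else 0)"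
      unfolding U_mat_def As_def[symmetric] using diag_block_mat_4_entry[OF As(1)] As(2) i k m nth by simp
    moreover have "psi_state n $ (4 * k) = complex_of_real (1 / sqrt (real n))"
      using k by (subst psi_state_index) (auto simp: circuit_dim_def)
    ultimately show "?U $$ (4 * i + m, 4 * k) * psi_state n $ (4 * k) =
      (if k = i then U_block (\<theta> (i + 1)) x $$ (m, 0) * complex_of_real (1 / sqrt (real n)) else 0)" by simp
  qed
  finally show ?thesis using i by simp
qed

text \<open>Basis kets are real, so the inner product reads off a coordinate; the squared amplitude
  \<open>1 / sqrt n\<close> gives the factor \<open>1 / n\<close>.\<close>

lemma outcome_prob_eq:
  assumes V: "prepares_psi n V" and m: "m < 4"
  shows "outcome_prob V n m \<theta> x = (\<Sum>i<n. (cmod (U_block (\<theta> (i + 1)) x $$ (m, 0)))\<^sup>2) / real n"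
  unfolding outcome_prob_def sum_divide_distrib
proof (intro sum.cong refl)
  fix i assume "i \<in> {..<n}"
  then have i: "i < n" by simp
  have r: "4 * i + m < circuit_dim n" using i m unfolding circuit_dim_def by simp
  define v where "v = circuit V n \<theta> x *\<^sub>v ket n 0"
  have "conjugate (ket n (4 * i + m)) = ket n (4 * i + m)"
    by (rule eq_vecI) (auto simp: ket_def unit_vec_def)
  then have "v \<bullet>c ket n (4 * i + m) = (\<Sum>j\<in>{0..<circuit_dim n}. v $ j * (if j = 4 * i + m then 1 else 0))"
    (is "_ = ?S") unfolding scalar_prod_def by (intro sum.cong) (auto simp: ket_def unit_vec_def)
  also have "?S = (\<Sum>j\<in>{0..<circuit_dim n}. if j = 4 * i + m then v $ j else 0)"
    by (intro sum.cong) auto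
  also have "\<dots> = v $ (4 * i + m)" using r by simp
  finally show "(cmod (v \<bullet>c ket n (4 * i + m)))\<^sup>2 = (cmod (U_block (\<theta> (i + 1)) x $$ (m, 0)))\<^sup>2 / real n"
    unfolding v_def circuit_state_index[OF V i m]
    by (simp add: norm_mult norm_divide power_mult_distrib power_divide)
qed

text \<open>Block \<open>i\<close> contributes \<open>(1 - ?c i) / 2\<close>, averaged over the
  blocks; the affine map defining the output cancels the constant part.\<close>

lemma qnn_output_eq:
  assumes V: "prepares_psi n V" and n: "n \<ge> 1"
  shows "qnn_output V R n \<theta> x =
    R / real n * (\<Sum>i<n. case \<theta> (i + 1) of (a, b, \<gamma>) \<Rightarrow> cos \<gamma> * cos (b + a \<bullet> x))"
proof -
  let ?c = "\<lambda>i. case \<theta> (i + 1) of (a, b, \<gamma>) \<Rightarrow> cos \<gamma> * cos (b + a \<bullet> x)"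
  have "outcome_prob V n 1 \<theta> x + outcome_prob V n 2 \<theta> x =
      (\<Sum>i<n. (cmod (U_block (\<theta> (i + 1)) x $$ (1, 0)))\<^sup>2 + (cmod (U_block (\<theta> (i + 1)) x $$ (2, 0)))\<^sup>2) / real n"
    using V by (simp add: outcome_prob_eq sum.distrib add_divide_distrib)
  also have "\<dots> = (\<Sum>i<n. (1 - ?c i) / 2) / real n"
    by (intro arg_cong2[where f = "(/)"] sum.cong refl) (simp split: prod.split add: U_block_entries[simplified])
  also have "\<dots> = (real n - (\<Sum>i<n. ?c i)) / 2 / real n"
    by (simp add: sum_divide_distrib[symmetric] sum_subtractf)
  finally have "qnn_output V R n \<theta> x = R - 2 * R * ((real n - (\<Sum>i<n. ?c i)) / 2 / real n)"
    unfolding qnn_output_def by (simp only:)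
  then show ?thesis using n by (simp add: field_simps)
qed

section \<open>Universal approximation\<close>

text \<open>Integrability is a separate conjunct because the integral of a non-integrable function
  is 0 by convention, which would make the error bound empty.\<close>

theorem mainTheorem3:
  fixes \<mu> :: "'d::{finite, linorder} point measure"
    and f :: "'d point \<Rightarrow> real"
    and V :: "nat \<Rightarrow> complex mat"
    and \<epsilon> :: real
  assumes "prob_space \<mu>" and "sets \<mu> = sets borel"
    and "f \<in> borel_measurable \<mu>" and "integrable \<mu> (\<lambda>x. \<bar>f x\<bar>\<^sup>2)"
    and "\<And>n. n \<ge> 1 \<Longrightarrow> prepares_psi n (V n)"
    and "\<epsilon> > 0"
  shows "\<exists>n R \<theta>. n \<ge> 1 \<and> R > 0 \<and> \<theta> \<in> param_space n \<and>
           integrable \<mu> (\<lambda>x. \<bar>f x - qnn_output (V n) R n \<theta> x\<bar>\<^sup>2) \<and>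
           sqrt (\<integral>x. \<bar>f x - qnn_output (V n) R n \<theta> x\<bar>\<^sup>2 \<partial>\<mu>) \<le> \<epsilon>"
proof -
  interpret prob_space \<mu> by fact
  interpret finite_borel \<mu> by unfold_locales fact
  have f2: "integrable \<mu> (\<lambda>x. (f x)\<^sup>2)" using assms(4) by simp
  have "approximable f" using assms(3) f2 by (rule approximable_square_integrable)
  moreover have "\<epsilon>\<^sup>2 > 0" using assms(6) by simp
  ultimately obtain p where p: "trig_poly p" and le: "(\<integral>x. (f x - p x)\<^sup>2 \<partial>\<mu>) < \<epsilon>\<^sup>2"
    unfolding approximable_def by blast
  from trig_poly_sum_cos[OF p] obtain n :: nat and c b a where n: "n \<ge> 1"
    and sum: "\<And>x. p x = (\<Sum>i<n. c i * cos (b i + a i \<bullet> x))" by blast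
  \<comment> \<open>The sum dominates every coefficient, so each \<open>c i / C\<close> is a cosine;
    the 1 keeps \<open>C\<close> positive if all coefficients vanish.\<close>
  define C where "C = 1 + (\<Sum>i<n. \<bar>c i\<bar>)"
  have C: "C > 0" unfolding C_def by (simp add: add_pos_nonneg sum_nonneg)
  have c_le: "\<bar>c i / C\<bar> \<le> 1" if "i < n" for i
  proof -
    have "\<bar>c i\<bar> \<le> (\<Sum>i<n. \<bar>c i\<bar>)" using that by (intro member_le_sum) auto
    then show ?thesis using C unfolding C_def by simp
  qed
  \<comment> \<open>The restricted abstraction makes \<open>\<theta>\<close> extensional on
    \<open>{1..n}\<close>, as \<open>param_space\<close> demands; \<open>j - 1\<close> converts to
    indices from 0.\<close>
  define \<theta> :: "'d params" where
    "\<theta> = (\<lambda>j\<in>{1..n}. (a (j - 1), b (j - 1), arccos (c (j - 1) / C)))"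
  have \<theta>: "\<theta> \<in> param_space n"
  proof -
    have "arccos (c (j - 1) / C) \<in> {0..2 * pi}" if "j \<in> {1..n}" for j
    proof -
      have "j - 1 < n" using that by auto
      from c_le[OF this] have "- 1 \<le> c (j - 1) / C" "c (j - 1) / C \<le> 1"
        by (simp_all only: abs_le_iff) linarith
      from arccos_bounded[OF this] show ?thesis using pi_gt_zero by auto
    qed
    then show ?thesis unfolding param_space_def \<theta>_def by auto
  qed
  \<comment> \<open>With \<open>R = n * C\<close> the prefactor \<open>R / n\<close> is
    \<open>C\<close>, which undoes the normalisation inside \<open>arccos\<close>.\<close>
  have q: "qnn_output (V n) (real n * C) n \<theta> x = p x" for x
  proof -
    have "qnn_output (V n) (real n * C) n \<theta> x = (\<Sum>i<n. C * (cos (arccos (c i / C)) * cos (b i + a i \<bullet> x)))"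
      unfolding qnn_output_eq[OF assms(5)[OF n] n] using n by (simp add: \<theta>_def sum_distrib_left)
    also have "\<dots> = (\<Sum>i<n. c i * cos (b i + a i \<bullet> x))"
      using c_le C by (intro sum.cong refl) (simp add: cos_arccos_abs)
    finally show ?thesis unfolding sum .
  qed
  have "integrable \<mu> (\<lambda>x. (f x - p x)\<^sup>2)"
    by (rule sq_integrable_diff[OF assms(3) trig_poly_measurable[OF p] f2 trig_poly_sq_integrable[OF p]])
  moreover have "sqrt (\<integral>x. (f x - p x)\<^sup>2 \<partial>\<mu>) \<le> \<epsilon>"
    using le assms(6) by (intro real_le_lsqrt) auto
  moreover have "real n * C > 0" using n C by simp
  ultimately show ?thesis
    using n \<theta> by (intro exI[of _ n] exI[of _ "real n * C"] exI[of _ \<theta>]) (simp add: q)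
qed

end
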